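(* Let $A\in\mathbb{H}^{n\times n}$ and let $q\in\mathbb{H}$ be a right eigenvalue of $A$. Then $$a.m.(q,A)\ \ge\ g.m.(q,A).$$
   Context: $\mathbb{H}$ is the algebra of real quaternions with units $i,j,k$, and $\mathbb{C}=\{a+bi: a,b\in\mathbb{R}\}\subset\mathbb{H}$. Two quaternions $q_1,q_2$ are similar if $q_1=h^{-1}q_2h$ for some nonzero $h\in\mathbb{H}$; $[q]$ denotes the similarity class of $q$. It is known that each class $[q]$ contains a unique complex number $\lambda_q$ with $\mathrm{Im}(\lambda_q)\ge0$. $\mathbb{H}^n$ is the space of column vectors of length $n$ with entries in $\mathbb{H}$, regarded as a right $\mathbb{H}$-vector space. A quaternion $q$ is a right eigenvalue of $A\in\mathbb{H}^{n\times n}$ if there is a nonzero $x\in\mathbb{H}^n$ with $Ax=xq$. $A^*$ is the conjugate transpose; $U$ is unitary if $U^*U=UU^*=Id$. Algebraic multiplicity: it is known that there are $U,T\in\mathbb{H}^{n\times n}$ with $U$ unitary, $T$ upper triangular, $T=U^*AU$, and all diagonal entries of $T$ complex numbers with nonnegative imaginary part. For a right eigenvalue $q$ of $A$, $a.m.(q,A)$ is the number of occurrences of $\lambda_q$ on the diagonal of such a $T$ (this number does not depend on the choice of $U,T$). Geometric multiplicity: for $\tilde q\in\mathbb{H}$ put $V_{\tilde q}=\{x\in\mathbb{H}^n: Ax=x\tilde q\}$. The $[q]$-eigenspace is $V_{[q]}:=\sum_{\tilde q\in[q]}V_{\tilde q}$, the set of all finite sums of vectors each lying in some $V_{\tilde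 q}$ with $\tilde q\in[q]$; it is a right $\mathbb{H}$-vector subspace of $\mathbb{H}^n$. Then $g.m.(q,A):=\dim_{\mathbb{H}}V_{[q]}$, the dimension as a right $\mathbb{H}$-vector space. *)

theory Defs
  imports "HOL-Analysis.Analysis"
begin

text \<open>\<open>Quat a b c d\<close> stands for \<open>a + b i + c j + d k\<close>.\<close>

datatype quat = Quat (qre: real) (qim_i: real) (qim_j: real) (qim_k: real)

lemma quat_eq_iff:
  "x = y \<longleftrightarrow> qre x = qre y \<and> qim_i x = qim_i y \<and> qim_j x = qim_j y \<and> qim_k x = qim_k y"
  by (cases x; cases y) simp

instantiation quat :: ring_1
begin

definition "0 = Quat 0 0 0 0"
definition "1 = Quat 1 0 0 0"
definition "- x = Quat (- qre x) (- qim_i x) (- qim_j x) (- qim_k x)"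
definition "x + y =
  Quat (qre x + qre y) (qim_i x + qim_i y) (qim_j x + qim_j y) (qim_k x + qim_k y)"
definition "x - y =
  Quat (qre x - qre y) (qim_i x - qim_i y) (qim_j x - qim_j y) (qim_k x - qim_k y)"
definition "x * y = Quat
  (qre x * qre y - qim_i x * qim_i y - qim_j x * qim_j y - qim_k x * qim_k y)
  (qre x * qim_i y + qim_i x * qre y + qim_j x * qim_k y - qim_k x * qim_j y)
  (qre x * qim_j y - qim_i x * qim_k y + qim_j x * qre y + qim_k x * qim_i y)
  (qre x * qim_k y + qim_i x * qim_j y - qim_j x * qim_i y + qim_k x * qre y)"

instance
  by standard
    (simp_all add: quat_eq_iff zero_quat_def one_quat_def uminus_quat_def plus_quat_def
      minus_quat_def times_quat_def algebra_simps)

end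

definition qcnj :: "quat \<Rightarrow> quat" where
  "qcnj x = Quat (qre x) (- qim_i x) (- qim_j x) (- qim_k x)"

definition qnorm2 :: "quat \<Rightarrow> real" where
  "qnorm2 x = (qre x)\<^sup>2 + (qim_i x)\<^sup>2 + (qim_j x)\<^sup>2 + (qim_k x)\<^sup>2"

lemma qnorm2_eq_0_iff: "qnorm2 x = 0 \<longleftrightarrow> x = 0"
  by (auto simp: qnorm2_def quat_eq_iff zero_quat_def add_nonneg_eq_0_iff)

instantiation quat :: division_ring
begin

definition "inverse x =
  Quat (qre x / qnorm2 x) (- qim_i x / qnorm2 x) (- qim_j x / qnorm2 x) (- qim_k x / qnorm2 x)"
definition "x div (y :: quat) = x * inverse y"

instance
proof
  fix x y :: quat
  show "x div y = x * inverse y" by (rule divide_quat_def)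
  show "inverse (0 :: quat) = 0" by (simp add: inverse_quat_def zero_quat_def)
  assume "x \<noteq> 0"
  then have n: "qnorm2 x \<noteq> 0" by (simp add: qnorm2_eq_0_iff)
  then have q: "(qre x * qre x + qim_i x * qim_i x + qim_j x * qim_j x + qim_k x * qim_k x)
      / qnorm2 x = 1"
    by (simp add: qnorm2_def power2_eq_square)
  show "inverse x * x = 1" "x * inverse x = 1"
    using q
    by (simp_all add: quat_eq_iff inverse_quat_def times_quat_def one_quat_def add_divide_distrib
        mult.commute)
qed

end

definition qsimilar :: "quat \<Rightarrow> quat \<Rightarrow> bool" where
  "qsimilar p q \<longleftrightarrow> (\<exists>h. h \<noteq> 0 \<and> p = inverse h * q * h)"

definition qclass :: "quat \<Rightarrow> quat set" where
  "qclass q = {p. qsimilar p q}"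

definition upper_complex :: "quat set" where
  "upper_complex = {z. qim_j z = 0 \<and> qim_k z = 0 \<and> qim_i z \<ge> 0}"

definition class_rep :: "quat \<Rightarrow> quat" where
  "class_rep q = (THE z. z \<in> qclass q \<and> z \<in> upper_complex)"

text \<open>The library's \<open>*s\<close> multiplies on the left, and its theory of dimension is restricted to
  commutative scalars, so the right vector space structure of \<open>quat ^ 'n\<close> is set up here.\<close>

definition rscale :: "quat ^ 'n \<Rightarrow> quat \<Rightarrow> quat ^ 'n" (infixl "*r" 70) where
  "x *r c = (\<chi> i. x $ i * c)"

definition right_span :: "(quat ^ 'n) set \<Rightarrow> (quat ^ 'n) set" where
  "right_span S = {\<Sum>v\<in>F. v *r c v | F c. finite F \<and> F \<subseteq> S}"

definition right_independent :: "(quat ^ 'n) set \<Rightarrow> bool" where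
  "right_independent S \<longleftrightarrow>
    (\<forall>F c. finite F \<longrightarrow> F \<subseteq> S \<longrightarrow> (\<Sum>v\<in>F. v *r c v) = 0 \<longrightarrow> (\<forall>v\<in>F. c v = 0))"

text \<open>Meaningful for right subspaces \<open>V\<close> only. These have bases, all finite and of the same
  cardinality, so the choice of basis is immaterial.\<close>

definition right_dim :: "(quat ^ 'n) set \<Rightarrow> nat" where
  "right_dim V = card (SOME B. right_independent B \<and> right_span B = V)"

definition right_eigenvalue :: "quat ^ 'n ^ 'n \<Rightarrow> quat \<Rightarrow> bool" where
  "right_eigenvalue A q \<longleftrightarrow> (\<exists>x. x \<noteq> 0 \<and> A *v x = x *r q)"

definition conj_transpose :: "quat ^ 'n ^ 'm \<Rightarrow> quat ^ 'm ^ 'n" where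
  "conj_transpose A = (\<chi> i j. qcnj (A $ j $ i))"

definition unitary :: "quat ^ 'n ^ 'n \<Rightarrow> bool" where
  "unitary U \<longleftrightarrow> conj_transpose U ** U = mat 1 \<and> U ** conj_transpose U = mat 1"

definition upper_triangular :: "quat ^ 'n::{finite,linorder} ^ 'n::{finite,linorder} \<Rightarrow> bool" where
  "upper_triangular T \<longleftrightarrow> (\<forall>i j. j < i \<longrightarrow> T $ i $ j = 0)"

definition schur_form :: "quat ^ 'n::{finite,linorder} ^ 'n::{finite,linorder} \<Rightarrow>
  quat ^ 'n::{finite,linorder} ^ 'n::{finite,linorder} \<Rightarrow> bool" where
  "schur_form A T \<longleftrightarrow>
    upper_triangular T \<and> (\<forall>i. T $ i $ i \<in> upper_complex) \<and>
    (\<exists>U. unitary U \<and> T = conj_transpose U ** A ** U)"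

text \<open>Every square matrix has a Schur form, and all its Schur forms give the same count, so the
  choice is immaterial.\<close>

definition alg_mult :: "quat \<Rightarrow> quat ^ 'n::{finite,linorder} ^ 'n::{finite,linorder} \<Rightarrow> nat" where
  "alg_mult q A = (let T = (SOME T. schur_form A T) in card {i. T $ i $ i = class_rep q})"

definition eigenvectors :: "quat ^ 'n ^ 'n \<Rightarrow> quat \<Rightarrow> (quat ^ 'n) set" where
  "eigenvectors A p = {x. A *v x = x *r p}"

definition class_eigenspace :: "quat ^ 'n ^ 'n \<Rightarrow> quat \<Rightarrow> (quat ^ 'n) set" where
  "class_eigenspace A q = {sum_list xs | xs. set xs \<subseteq> (\<Union>p\<in>qclass q. eigenvectors A p)}"

definition geom_mult :: "quat \<Rightarrow> quat ^ 'n ^ 'n \<Rightarrow> nat" where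
  "geom_mult q A = right_dim (class_eigenspace A q)"

end

theory Submission
  imports Defs "HOL-Computational_Algebra.Fundamental_Theorem_Algebra"
begin

text \<open>All members of \<open>[q]\<close> are roots of the real polynomial
  \<open>t\<^sup>2 - 2 Re(q) t + |q|\<^sup>2\<close>, so in the coordinates of a Schur form \<open>T\<close> the eigenspace
  \<open>V\<^bsub>[q]\<^esub>\<close> lies in the kernel of this polynomial at \<open>T\<close>. If \<open>i\<close> is the last index
  at which a kernel vector is nonzero, then \<open>T\<^bsub>ii\<^esub>\<close> is a root as well, hence equals
  \<open>\<lambda>\<^bsub>q\<^esub>\<close>. Thus a kernel vector is determined by its coordinates at the positions where
  the diagonal entry is \<open>\<lambda>\<^bsub>q\<^esub>\<close>. Schur forms exist because, by the fundamental theorem of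
  algebra, a matrix has an eigenvector with complex eigenvalue modulo each proper invariant
  subspace; right multiplication by \<open>j\<close> conjugates the eigenvalue if its imaginary part is
  negative.\<close>

section \<open>Linear systems over division rings\<close>

text \<open>Gaussian elimination by induction on the set of equations. Coefficients stand to the
  left of the unknowns, so equations combine through left multiples. Every dimension count below
  rests on this.\<close>

lemma homogeneous_system_nontrivial:
  fixes a :: "'i \<Rightarrow> 'f \<Rightarrow> 'a::division_ring"
  assumes "finite I" "finite F" "card I < card F"
  shows "\<exists>c. (\<exists>f\<in>F. c f \<noteq> 0) \<and> (\<forall>i\<in>I. (\<Sum>f\<in>F. a i f * c f) = 0)"
  using assms
proof (induction I arbitrary: F a rule: finite_induct)
  case empty
  then obtain f where "f \<in> F" by (metis card_gt_0_iff card.empty ex_in_conv)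
  then show ?case by (intro exI[of _ "\<lambda>_. 1"]) auto
next
  case (insert i I)
  show ?case
  proof (cases "\<forall>f\<in>F. a i f = 0")
    case True
    from insert have "card I < card F" by simp
    from insert.IH[OF insert.prems(1) this, of a] True show ?thesis by auto
  next
    case False
    then obtain f0 where f0: "f0 \<in> F" "a i f0 \<noteq> 0" by auto
    define F' where "F' = F - {f0}"
    \<comment> \<open>Subtracting a left multiple of equation \<open>i\<close> removes the unknown
      \<open>f0\<close> from equation \<open>k\<close>.\<close>
    define a' where "a' = (\<lambda>k f. a k f - a k f0 * inverse (a i f0) * a i f)"
    have "finite F'" "card I < card F'"
      using insert f0 by (auto simp: F'_def)
    from insert.IH[OF this, of a'] obtain c where c: "\<exists>f\<in>F'. c f \<noteq> 0"
      "\<And>k. k \<in> I \<Longrightarrow> (\<Sum>f\<in>F'. a' k f * c f) = 0" by auto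
    define s where "s = (\<Sum>f\<in>F'. a i f * c f)"
    define d where "d = c(f0 := - (inverse (a i f0) * s))"
    have split: "(\<Sum>f\<in>F. a k f * d f) = a k f0 * d f0 + (\<Sum>f\<in>F'. a k f * c f)" for k
    proof -
      have "(\<Sum>f\<in>F'. a k f * d f) = (\<Sum>f\<in>F'. a k f * c f)"
        by (rule sum.cong) (auto simp: d_def F'_def)
      then show ?thesis
        using f0 insert.prems by (simp add: F'_def sum.remove[of F f0])
    qed
    have "(\<Sum>f\<in>F. a i f * d f) = 0"
      using f0 by (simp add: split s_def[symmetric]) (simp add: d_def mult.assoc[symmetric])
    moreover have "(\<Sum>f\<in>F. a k f * d f) = 0" if "k \<in> I" for k
    proof -
      have "(\<Sum>f\<in>F'. a k f * c f) = a k f0 * (inverse (a i f0) * s)"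
        using c(2)[OF that]
        by (simp add: a'_def s_def sum_subtractf left_diff_distrib sum_distrib_left mult.assoc)
      then show ?thesis by (simp only: split) (simp add: d_def)
    qed
    moreover have "\<exists>f\<in>F. d f \<noteq> 0" using c(1) by (auto simp: d_def F'_def)
    ultimately show ?thesis by auto
  qed
qed

text \<open>\<open>B\<close> is injective: the columns of \<open>A\<close> together with a vector
  \<open>w\<close> such that \<open>B *v w = 0\<close> satisfy a nontrivial relation, and applying
  \<open>B\<close> to it kills all coefficients but that of \<open>w\<close>. Moreover
  \<open>B\<close> maps \<open>A *v (B *v y) - y\<close> to zero.\<close>

lemma matrix_left_right_inverse_division_ring:
  fixes A B :: "'a::division_ring ^ 'n ^ 'n"
  assumes BA: "B ** A = mat 1"
  shows "A ** B = mat 1"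
proof -
  have ker: "w = 0" if "B *v w = 0" for w
  proof -
    define a where "a = (\<lambda>i f. case f of None \<Rightarrow> w $ i | Some j \<Rightarrow> A $ i $ j)"
    have "card (UNIV :: 'n set) < card (UNIV :: 'n option set)"
      by simp
    from homogeneous_system_nontrivial[OF _ _ this, of a] obtain c where
      c: "\<exists>f. c f \<noteq> 0" "\<And>i. (\<Sum>f\<in>UNIV. a i f * c f) = 0" by auto
    define d where "d = (\<chi> j. c (Some j))"
    define e where "e = (\<chi> i. w $ i * c None)"
    have sum0: "A *v d + e = 0"
      using c(2) by (simp add: vec_eq_iff matrix_vector_mult_def d_def e_def a_def UNIV_option_conv
          sum.reindex add.commute)
    have Be: "B *v e = 0"
    proof -
      have "(B *v e) $ i = (B *v w) $ i * c None" for i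
        by (simp add: matrix_vector_mult_def e_def sum_distrib_right mult.assoc)
      then show ?thesis by (simp add: that vec_eq_iff)
    qed
    have "B *v (A *v d + e) = d"
      using BA Be by (simp add: matrix_vector_right_distrib matrix_vector_mul_assoc)
    then have "d = 0" using sum0 by simp
    then have "c (Some j) = 0" for j by (simp add: d_def vec_eq_iff)
    then have "c None \<noteq> 0" using c(1) by (metis option.exhaust)
    moreover have "e = 0" using sum0 \<open>d = 0\<close> by simp
    ultimately show ?thesis by (simp add: e_def vec_eq_iff)
  qed
  have "A *v (B *v y) = y" for y
  proof -
    have "B *v (A *v (B *v y) - y) = 0"
      using BA by (simp add: matrix_vector_mult_diff_distrib matrix_vector_mul_assoc matrix_mul_assoc)
    then show ?thesis using ker by fastforce
  qed
  then show ?thesis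
    by (metis matrix_eq matrix_vector_mul_assoc matrix_vector_mul_lid)
qed

section \<open>Quaternions\<close>

lemmas quat_simps = quat_eq_iff zero_quat_def one_quat_def uminus_quat_def plus_quat_def
  minus_quat_def times_quat_def

lemma qcnj_0 [simp]: "qcnj 0 = 0"
  by (simp add: qcnj_def quat_simps)

lemma qcnj_add: "qcnj (x + y) = qcnj x + qcnj y"
  by (simp add: qcnj_def quat_simps)

lemma qcnj_mult: "qcnj (x * y) = qcnj y * qcnj x"
  by (simp add: qcnj_def quat_simps algebra_simps)

lemma qcnj_qcnj [simp]: "qcnj (qcnj x) = x"
  by (simp add: qcnj_def quat_simps)

lemma qcnj_sum: "qcnj (\<Sum>i\<in>I. f i) = (\<Sum>i\<in>I. qcnj (f i))"
  by (induction I rule: infinite_finite_induct) (simp_all add: qcnj_add)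

definition quat_of_real :: "real \<Rightarrow> quat" where
  "quat_of_real r = Quat r 0 0 0"

lemma quat_of_real_0 [simp]: "quat_of_real 0 = 0"
  by (simp add: quat_of_real_def quat_simps)

lemma quat_of_real_1 [simp]: "quat_of_real 1 = 1"
  by (simp add: quat_of_real_def quat_simps)

lemma quat_of_real_add: "quat_of_real (r + s) = quat_of_real r + quat_of_real s"
  by (simp add: quat_of_real_def quat_simps)

lemma quat_of_real_mult: "quat_of_real (r * s) = quat_of_real r * quat_of_real s"
  by (simp add: quat_of_real_def quat_simps)

lemma quat_of_real_sum: "quat_of_real (\<Sum>i\<in>I. f i) = (\<Sum>i\<in>I. quat_of_real (f i))"
  by (induction I rule: infinite_finite_induct) (simp_all add: quat_of_real_add)

lemma quat_of_real_commute: "quat_of_real r * x = x * quat_of_real r"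
  by (simp add: quat_of_real_def quat_simps)

lemma qcnj_quat_of_real [simp]: "qcnj (quat_of_real r) = quat_of_real r"
  by (simp add: quat_of_real_def qcnj_def)

lemma qcnj_mult_self: "qcnj x * x = quat_of_real (qnorm2 x)"
  by (simp add: quat_of_real_def qcnj_def qnorm2_def quat_simps power2_eq_square)

lemma qnorm2_nonneg: "0 \<le> qnorm2 x"
  by (simp add: qnorm2_def)

lemma qnorm2_mult: "qnorm2 (x * y) = qnorm2 x * qnorm2 y"
  by (simp add: qnorm2_def quat_simps power2_eq_square algebra_simps)

lemma qre_mult_commute: "qre (x * y) = qre (y * x)"
  by (simp add: quat_simps algebra_simps)

definition quat_of_complex :: "complex \<Rightarrow> quat" where
  "quat_of_complex z = Quat (Re z) (Im z) 0 0"

lemma quat_of_complex_0 [simp]: "quat_of_complex 0 = 0"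
  by (simp add: quat_of_complex_def quat_simps)

lemma quat_of_complex_diff: "quat_of_complex (z - w) = quat_of_complex z - quat_of_complex w"
  by (simp add: quat_of_complex_def quat_simps)

lemma quat_of_complex_mult: "quat_of_complex (z * w) = quat_of_complex z * quat_of_complex w"
  by (simp add: quat_of_complex_def quat_simps)

lemma quat_of_complex_eq_0_iff [simp]: "quat_of_complex z = 0 \<longleftrightarrow> z = 0"
  by (simp add: quat_of_complex_def quat_simps complex_eq_iff)

section \<open>Similarity classes\<close>

text \<open>The real part is invariant under cyclic permutation of factors, and
  \<open>qnorm2\<close> is multiplicative.\<close>

lemma qsimilar_re_norm:
  assumes "qsimilar p q"
  shows "qre p = qre q" "qnorm2 p = qnorm2 q"
proof -
  obtain h where h: "h \<noteq> 0" "p = inverse h * q * h" using assms by (auto simp: qsimilar_def)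
  have hi: "h * inverse h = 1" using h by simp
  have "qre p = qre (h * (inverse h * q))" using h(2) by (metis qre_mult_commute)
  then show "qre p = qre q" by (simp only: mult.assoc[symmetric] hi) simp
  have "qnorm2 h * qnorm2 (inverse h) = 1"
    by (simp add: qnorm2_mult[symmetric] hi) (simp add: qnorm2_def quat_simps)
  then show "qnorm2 p = qnorm2 q"
    by (simp add: h(2) qnorm2_mult algebra_simps)
qed

text \<open>Cayley-Hamilton for a quaternion with trace \<open>2 * qre p\<close> and norm
  \<open>qnorm2 p\<close>.\<close>

lemma quat_quadratic_identity:
  "p * p - p * quat_of_real (2 * qre p) + quat_of_real (qnorm2 p) = 0"
  by (simp add: quat_of_real_def qnorm2_def quat_simps power2_eq_square algebra_simps)

lemma upper_complex_quadratic_root: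
  assumes "z \<in> upper_complex"
    and "z * z - z * quat_of_real (2 * qre q) + quat_of_real (qnorm2 q) = 0"
  shows "qre z = qre q" "qim_i z = sqrt (qnorm2 q - (qre q)\<^sup>2)"
proof -
  define x y a b where "x = qre z" and "y = qim_i z" and "a = qre q" and "b = qnorm2 q"
  have y: "y \<ge> 0" and z: "z = Quat x y 0 0"
    using assms(1) by (auto simp: upper_complex_def x_def y_def quat_eq_iff)
  have e1: "x * x - y * y - x * (2 * a) + b = 0" and e2: "x * y + y * x - y * (2 * a) = 0"
    using assms(2) unfolding z a_def[symmetric] b_def[symmetric]
    by (simp_all add: quat_of_real_def quat_simps)
  have ba: "b - a\<^sup>2 \<ge> 0" by (simp add: a_def b_def qnorm2_def)
  \<comment> \<open>If \<open>y\<close> is nonzero, the i-component \<open>e2\<close> decides; if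
    \<open>y = 0\<close>, then \<open>e1\<close> makes two nonnegative terms add up to zero.\<close>
  have xa: "x = a"
  proof (cases "y = 0")
    case True
    then have "(x - a)\<^sup>2 + (b - a\<^sup>2) = 0"
      using e1 by (simp add: power2_eq_square algebra_simps)
    then show ?thesis using ba
      by (smt (verit) zero_le_power2 zero_eq_power2)
  next
    case False
    have "y * (x - a) = 0" using e2 by (simp add: algebra_simps)
    then show ?thesis using False by simp
  qed
  then have "b - a\<^sup>2 = y\<^sup>2" using e1 by (simp add: power2_eq_square)
  then show "qre z = qre q" "qim_i z = sqrt (qnorm2 q - (qre q)\<^sup>2)"
    using xa y by (simp_all add: x_def y_def a_def b_def)
qed

lemma qsimilar_quadratic:
  assumes "qsimilar p q"
  shows "p * p - p * quat_of_real (2 * qre q) + quat_of_real (qnorm2 q) = 0"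
  using quat_quadratic_identity[of p] qsimilar_re_norm[OF assms] by simp

lemma ex_upper_complex_similar: "\<exists>z. z \<in> qclass q \<and> z \<in> upper_complex"
proof -
  define r where "r = sqrt ((qim_i q)\<^sup>2 + (qim_j q)\<^sup>2 + (qim_k q)\<^sup>2)"
  have r: "r \<ge> 0" "r * r = (qim_i q)\<^sup>2 + (qim_j q)\<^sup>2 + (qim_k q)\<^sup>2"
    by (simp_all add: r_def)
  define z where "z = Quat (qre q) r 0 0"
  have "\<exists>h. h \<noteq> 0 \<and> q * h = h * z"
  proof -
    \<comment> \<open>With \<open>v\<close> the imaginary part of \<open>q\<close> and \<open>r = |v|\<close>, the quaternion \<open>v i - r\<close> solves
      \<open>v h = h (r i)\<close>; it vanishes only if \<open>v = - r i\<close>, where \<open>j\<close> does the job.\<close>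
    define h where "h = Quat 0 (qim_i q) (qim_j q) (qim_k q) * Quat 0 1 0 0 - quat_of_real r"
    have "q * h = h * z"
      using r(2)
      by (simp add: h_def z_def quat_of_real_def quat_simps power2_eq_square algebra_simps)
    moreover have "q * Quat 0 0 1 0 = Quat 0 0 1 0 * z" if "h = 0"
      using that by (simp add: h_def z_def quat_of_real_def quat_simps)
    moreover have "Quat 0 0 1 0 \<noteq> 0" by (simp add: quat_simps)
    ultimately show ?thesis by blast
  qed
  then obtain h where h: "h \<noteq> 0" "q * h = h * z" by auto
  then have "z = inverse h * q * h"
    by (simp add: mult.assoc) (simp add: mult.assoc[symmetric])
  then have "z \<in> qclass q" using h by (auto simp: qclass_def qsimilar_def)
  moreover have "z \<in> upper_complex" using r by (simp add: z_def upper_complex_def)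
  ultimately show ?thesis by auto
qed

lemma upper_complex_quadratic_unique:
  assumes "z \<in> upper_complex" "w \<in> upper_complex"
    and "z * z - z * quat_of_real (2 * qre q) + quat_of_real (qnorm2 q) = 0"
    and "w * w - w * quat_of_real (2 * qre q) + quat_of_real (qnorm2 q) = 0"
  shows "z = w"
  using upper_complex_quadratic_root[OF assms(1,3)] upper_complex_quadratic_root[OF assms(2,4)]
    assms(1,2) by (simp add: quat_eq_iff upper_complex_def)

text \<open>Two members of the class in \<open>upper_complex\<close> would be roots of the same
  quadratic, which has at most one root there; so the definite description is meaningful.\<close>

lemma class_rep:
  shows "class_rep q \<in> qclass q" "class_rep q \<in> upper_complex"
proof -
  have "\<exists>!z. z \<in> qclass q \<and> z \<in> upper_complex"
    using ex_upper_complex_similar[of q] upper_complex_quadratic_unique[of _ _ q] qsimilar_quadratic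
    by (auto simp: qclass_def)
  from theI'[OF this] show "class_rep q \<in> qclass q" "class_rep q \<in> upper_complex"
    by (simp_all add: class_rep_def)
qed

lemma upper_complex_root_eq_class_rep:
  assumes "z \<in> upper_complex"
    and "z * z - z * quat_of_real (2 * qre q) + quat_of_real (qnorm2 q) = 0"
  shows "z = class_rep q"
  using upper_complex_quadratic_unique[OF assms(1) class_rep(2) assms(2)] qsimilar_quadratic
    class_rep(1)[of q] by (simp add: qclass_def)

section \<open>Right vector spaces\<close>

lemma rscale_0_left [simp]: "0 *r c = 0"
  and rscale_0_right [simp]: "x *r 0 = 0"
  and rscale_1 [simp]: "x *r 1 = x"
  and rscale_rscale: "x *r c *r d = x *r (c * d)"
  and rscale_add_left: "(x + y) *r c = x *r c + y *r c"
  and rscale_add_right: "x *r (c + d) = x *r c + x *r d"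
  and rscale_diff_left: "(x - y) *r c = x *r c - y *r c"
  and rscale_diff_right: "x *r (c - d) = x *r c - x *r d"
  and rscale_minus_right: "x *r (- c) = - (x *r c)"
  by (simp_all add: rscale_def vec_eq_iff algebra_simps)

lemma rscale_nth [simp]: "(x *r c) $ i = x $ i * c"
  by (simp add: rscale_def)

lemma rscale_sum_left: "(\<Sum>i\<in>I. f i) *r c = (\<Sum>i\<in>I. f i *r c)"
  by (induction I rule: infinite_finite_induct) (simp_all add: rscale_add_left)

lemma matrix_vector_rscale: "A *v (x *r c) = (A *v x) *r c"
  by (simp add: vec_eq_iff matrix_vector_mult_def sum_distrib_right mult.assoc)

lemma matrix_vector_sum: "A *v (\<Sum>i\<in>I. f i) = (\<Sum>i\<in>I. A *v (f i :: quat ^ 'n))"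
  by (induction I rule: infinite_finite_induct) (simp_all add: matrix_vector_right_distrib)

definition right_subspace :: "(quat ^ 'n) set \<Rightarrow> bool" where
  "right_subspace S \<longleftrightarrow>
    0 \<in> S \<and> (\<forall>x\<in>S. \<forall>y\<in>S. x + y \<in> S) \<and> (\<forall>x\<in>S. \<forall>c. x *r c \<in> S)"

lemma right_subspace_0: "right_subspace S \<Longrightarrow> 0 \<in> S"
  and right_subspace_add: "right_subspace S \<Longrightarrow> x \<in> S \<Longrightarrow> y \<in> S \<Longrightarrow> x + y \<in> S"
  and right_subspace_rscale: "right_subspace S \<Longrightarrow> x \<in> S \<Longrightarrow> x *r c \<in> S"
  by (auto simp: right_subspace_def)

lemma right_subspace_diff:
  assumes "right_subspace S" "x \<in> S" "y \<in> S"
  shows "x - y \<in> S"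
  using right_subspace_add[OF assms(1,2) right_subspace_rscale[OF assms(1,3), of "- 1"]]
  by (simp add: rscale_minus_right)

lemma right_subspace_sum:
  assumes "right_subspace S" "\<And>i. i \<in> I \<Longrightarrow> f i \<in> S"
  shows "(\<Sum>i\<in>I. f i) \<in> S"
  using assms(2)
  by (induction I rule: infinite_finite_induct)
    (auto intro: right_subspace_0 right_subspace_add assms(1))

lemma right_subspace_rscale_iff:
  assumes "right_subspace S" "c \<noteq> 0"
  shows "x *r c \<in> S \<longleftrightarrow> x \<in> S"
  using right_subspace_rscale[OF assms(1), of "x *r c" "inverse c"]
    right_subspace_rscale[OF assms(1), of x c] assms(2)
  by (auto simp: rscale_rscale)

text \<open>Read coordinatewise, a relation among the vectors of \<open>B\<close> is a system of n
  equations in \<open>card B\<close> unknowns.\<close>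

lemma right_independent_card_le:
  fixes B :: "(quat ^ 'n) set"
  assumes "right_independent B" "finite B"
  shows "card B \<le> CARD('n)"
proof (rule ccontr)
  assume "\<not> ?thesis"
  then have "card (UNIV :: 'n set) < card B" by simp
  from homogeneous_system_nontrivial[OF _ assms(2) this, of "\<lambda>i v. v $ i"] obtain c where
    "\<exists>v\<in>B. c v \<noteq> 0" "\<And>i. (\<Sum>v\<in>B. v $ i * c v) = 0" by auto
  moreover from this(2) have "(\<Sum>v\<in>B. v *r c v) = 0" by (simp add: vec_eq_iff)
  ultimately show False using assms unfolding right_independent_def by blast
qed

text \<open>An independent subset of greatest cardinality spans; it exists because cardinalities are
  bounded by n.\<close>

lemma right_subspace_has_basis:
  fixes V :: "(quat ^ 'n) set"
  assumes V: "right_subspace V"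
  shows "\<exists>B. right_independent B \<and> right_span B = V"
proof -
  define P where "P = (\<lambda>B. finite B \<and> B \<subseteq> V \<and> right_independent B)"
  have "P {}" by (auto simp: P_def right_independent_def)
  moreover have "\<forall>B. P B \<longrightarrow> card B < Suc CARD('n)"
    using right_independent_card_le by (auto simp: P_def less_Suc_eq_le)
  ultimately obtain B where B: "P B" and max: "\<And>B'. P B' \<Longrightarrow> card B' \<le> card B"
    using ex_has_greatest_nat[of P "{}" card] by blast
  have fin: "finite B" and sub: "B \<subseteq> V" and ind: "right_independent B"
    using B by (auto simp: P_def)
  have "right_span B \<subseteq> V"
    using sub by (auto simp: right_span_def intro!: right_subspace_sum right_subspace_rscale V)
  moreover have "v \<in> right_span B" if v: "v \<in> V" for v
  proof (cases "v \<in> B")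
    case True
    have "v = (\<Sum>u\<in>{v}. u *r 1)" by simp
    then show ?thesis using True unfolding right_span_def
      by (intro CollectI exI[of _ "{v}"] exI[of _ "\<lambda>_. 1"]) auto
  next
    case False
    then have "card (insert v B) > card B" using fin by simp
    then have "\<not> P (insert v B)" using max by (metis not_le)
    then have "\<not> right_independent (insert v B)" using fin sub v by (simp add: P_def)
    then obtain F c where F: "finite F" "F \<subseteq> insert v B" "(\<Sum>u\<in>F. u *r c u) = 0"
      "\<exists>u\<in>F. c u \<noteq> 0"
      by (auto simp: right_independent_def)
    have indF: "\<forall>u\<in>G. c u = 0" if "G \<subseteq> B" "finite G" "(\<Sum>u\<in>G. u *r c u) = 0" for G
      using ind that by (auto simp: right_independent_def)
    have vF: "v \<in> F"
    proof (rule ccontr)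
      assume "v \<notin> F"
      then show False using indF[of F] F by blast
    qed
    define G where "G = F - {v}"
    have G: "G \<subseteq> B" "finite G" using F by (auto simp: G_def)
    have eq: "v *r c v + (\<Sum>u\<in>G. u *r c u) = 0"
      using F vF by (simp add: G_def sum.remove[of F v])
    \<comment> \<open>A nonzero coefficient of \<open>v\<close> can be divided out on the right,
      which expresses \<open>v\<close> through \<open>B\<close>.\<close>
    have cv: "c v \<noteq> 0"
    proof
      assume "c v = 0"
      then have "\<forall>u\<in>G. c u = 0" using indF[OF G] eq by simp
      then show False using F(4) \<open>c v = 0\<close> by (auto simp: G_def)
    qed
    have "v = (v *r c v) *r inverse (c v)" using cv by (simp add: rscale_rscale)
    also have "v *r c v = - (\<Sum>u\<in>G. u *r c u)" using eq by (simp add: eq_neg_iff_add_eq_0)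
    also have "\<dots> *r inverse (c v) = (\<Sum>u\<in>G. u *r (- (c u * inverse (c v))))"
      by (simp add: vec_eq_iff sum_negf[symmetric] sum_distrib_right mult.assoc)
    finally show ?thesis using G unfolding right_span_def
      by (intro CollectI exI[of _ G] exI[of _ "\<lambda>u. - (c u * inverse (c v))"]) auto
  qed
  ultimately show ?thesis using ind by blast
qed

section \<open>Eigenvectors modulo an invariant subspace\<close>

text \<open>The evaluation of a complex polynomial at a matrix makes sense on the right complex vector
  space underlying the quaternionic column vectors; \<open>N\<close> is any bound on the degree.\<close>

definition poly_act :: "nat \<Rightarrow> quat ^ 'n ^ 'n \<Rightarrow> quat ^ 'n \<Rightarrow> complex poly \<Rightarrow> quat ^ 'n" where
  "poly_act N A y P = (\<Sum>k\<le>N. (((*v) A) ^^ k) y *r quat_of_complex (coeff P k))"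

lemma poly_act_diff: "poly_act N A y (P - Q) = poly_act N A y P - poly_act N A y Q"
  by (simp add: poly_act_def quat_of_complex_diff rscale_diff_right sum_subtractf)

lemma poly_act_smult: "poly_act N A y (smult z P) = poly_act N A y P *r quat_of_complex z"
  by (simp add: poly_act_def rscale_sum_left rscale_rscale quat_of_complex_mult[symmetric]
      mult.commute)

lemma poly_act_pCons_0: "poly_act (Suc N) A y (pCons 0 P) = A *v poly_act N A y P"
  by (simp add: poly_act_def sum.atMost_Suc_shift matrix_vector_sum matrix_vector_rscale
      del: sum.atMost_Suc)

lemma poly_act_Suc:
  "degree P \<le> N \<Longrightarrow> poly_act (Suc N) A y P = poly_act N A y P"
  by (simp add: poly_act_def coeff_eq_0)

text \<open>Complex coefficients act on the right and commute with each other, so \<open>Q\<close>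
  can be evaluated first. The extra factor raises the degree bound by one.\<close>

lemma poly_act_linear_factor:
  assumes "degree Q \<le> N"
  shows "poly_act (Suc N) A y ([:- z, 1:] * Q) =
    A *v poly_act N A y Q - poly_act N A y Q *r quat_of_complex z"
proof -
  have "[:- z, 1:] * Q = pCons 0 Q - smult z Q" by simp
  then show ?thesis
    using assms by (simp only: poly_act_diff poly_act_smult poly_act_pCons_0 poly_act_Suc)
qed

text \<open>The column vectors have 2n complex coordinates, so the 2n+1 vectors \<open>y\<close>,
  \<open>A y\<close>, ..., \<open>A^N y\<close> with N = 2n are dependent over the complex
  numbers.\<close>

lemma ex_annihilating_poly:
  fixes A :: "quat ^ 'n ^ 'n"
  shows "\<exists>N P. P \<noteq> 0 \<and> degree P \<le> N \<and> poly_act N A y P = 0"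
proof -
  \<comment> \<open>The coordinates of \<open>p\<close> over the complex numbers are the \<open>\<alpha>\<close>, \<open>\<beta>\<close> with
    \<open>p = \<alpha> + j \<beta>\<close>.\<close>
  define coord where "coord = (\<lambda>b p. if b then Complex (qre p) (qim_i p)
    else Complex (qim_j p) (- qim_k p))"
  have coord_add: "coord b (p + p') = coord b p + coord b p'" for b p p'
    by (simp add: coord_def quat_simps complex_eq_iff)
  have coord_sum: "coord b (\<Sum>k\<in>K. f k) = (\<Sum>k\<in>K. coord b (f k))" for b and K :: "nat set" and f
    by (induction K rule: infinite_finite_induct)
      (simp_all add: coord_add, simp_all add: coord_def quat_simps complex_eq_iff)
  have coord_mult: "coord b (p * quat_of_complex z) = coord b p * z" for b p z
    by (simp add: coord_def quat_of_complex_def quat_simps complex_eq_iff algebra_simps)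
  have coord_0: "p = 0" if "\<And>b. coord b p = 0" for p
    using that[of True] that[of False] by (simp add: coord_def quat_simps complex_eq_iff)
  define N where "N = CARD('n \<times> bool)"
  define w where "w = (\<lambda>k. (((*v) A) ^^ k) y)"
  have "card (UNIV :: ('n \<times> bool) set) < card {..N}" by (simp add: N_def)
  from homogeneous_system_nontrivial[OF _ _ this, of "\<lambda>(i, b) k. coord b (w k $ i)"] obtain c
    where c: "\<exists>k\<le>N. c k \<noteq> 0" "\<And>i b. (\<Sum>k\<le>N. coord b (w k $ i) * c k) = 0"
    by fastforce
  define P where "P = (\<Sum>k\<le>N. monom (c k) k)"
  have coeff_P: "coeff P k = (if k \<le> N then c k else 0)" for k
    by (simp add: P_def coeff_sum)
  have "P \<noteq> 0" using c(1) coeff_P by (metis coeff_0)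
  moreover have "degree P \<le> N" by (rule degree_le) (simp add: coeff_P)
  moreover have "poly_act N A y P = 0"
  proof -
    have "coord b (poly_act N A y P $ i) = 0" for b i
      using c(2)[of b i] by (simp add: poly_act_def coeff_P w_def coord_sum coord_mult)
    then show ?thesis using coord_0 by (simp add: vec_eq_iff)
  qed
  ultimately show ?thesis by blast
qed

text \<open>Take a nonzero \<open>P\<close> of least degree with \<open>P(A) y\<close> in
  \<open>S\<close> and split off a linear factor \<open>t - z\<close>. By minimality the cofactor
  \<open>Q\<close> leaves \<open>Q(A) y\<close> outside \<open>S\<close>, and this is an eigenvector
  modulo \<open>S\<close>.\<close>

lemma ex_eigenvector_mod_subspace:
  fixes A :: "quat ^ 'n ^ 'n"
  assumes S: "right_subspace S" and y: "y \<notin> S"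
  shows "\<exists>x z. x \<notin> S \<and> z \<in> upper_complex \<and> A *v x - x *r z \<in> S"
proof -
  define R where "R = (\<lambda>d. \<exists>N P. P \<noteq> 0 \<and> degree P = d \<and> d \<le> N \<and> poly_act N A y P \<in> S)"
  have "\<exists>d. R d"
    using ex_annihilating_poly[of A y] right_subspace_0[OF S] unfolding R_def by metis
  then have R: "R (Least R)" and least: "\<And>d. R d \<Longrightarrow> Least R \<le> d"
    by (auto intro: LeastI_ex Least_le)
  obtain N P where P: "P \<noteq> 0" "degree P = Least R" "degree P \<le> N" "poly_act N A y P \<in> S"
    using R unfolding R_def by metis
  \<comment> \<open>A nonzero constant would put a nonzero multiple of \<open>y\<close>, hence
    \<open>y\<close> itself, into \<open>S\<close>.\<close>
  have "degree P \<noteq> 0"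
  proof
    assume "degree P = 0"
    then obtain a where a: "P = [:a:]" by (rule degree_eq_zeroE)
    have "poly_act N A y P = y *r quat_of_complex a"
      by (simp add: a poly_act_def sum.atMost_shift)
    then show False using P(1,4) y by (simp add: a right_subspace_rscale_iff[OF S])
  qed
  then obtain z where "poly P z = 0"
    using fundamental_theorem_of_algebra[of P] by (auto simp: constant_degree)
  then obtain Q where Q: "P = [:- z, 1:] * Q" by (auto simp: poly_eq_0_iff_dvd dvd_def)
  have "Q \<noteq> 0" using P(1) Q by auto
  then have deg: "degree P = Suc (degree Q)" unfolding Q by (subst degree_mult_eq) auto
  obtain M where M: "N = Suc M" "degree Q \<le> M" using P(3) deg by (cases N) auto
  define x where "x = poly_act M A y Q"
  have xS: "x \<notin> S"
  proof
    assume "x \<in> S"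
    then have "R (degree Q)" using \<open>Q \<noteq> 0\<close> M unfolding R_def x_def by blast
    then show False using least deg P(2) by fastforce
  qed
  have eig: "A *v x - x *r quat_of_complex z \<in> S"
    using P(4) poly_act_linear_factor[OF M(2), of A y z] by (simp add: M(1) Q x_def)
  show ?thesis
  proof (cases "Im z \<ge> 0")
    case True
    then have "quat_of_complex z \<in> upper_complex"
      by (simp add: upper_complex_def quat_of_complex_def)
    then show ?thesis using xS eig by blast
  next
    case False
    define j where "j = Quat 0 0 1 0"
    have zj: "quat_of_complex z * j = j * quat_of_complex (cnj z)" and "j \<noteq> 0"
      by (simp_all add: j_def quat_of_complex_def quat_simps)
    have "A *v (x *r j) - x *r j *r quat_of_complex (cnj z) =
        (A *v x - x *r quat_of_complex z) *r j"
      by (simp add: matrix_vector_rscale rscale_diff_left rscale_rscale zj)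
    then have "A *v (x *r j) - x *r j *r quat_of_complex (cnj z) \<in> S"
      using right_subspace_rscale[OF S eig] by simp
    moreover have "x *r j \<notin> S" using xS \<open>j \<noteq> 0\<close> by (simp add: right_subspace_rscale_iff[OF S])
    ultimately show ?thesis using False
      by (intro exI[of _ "x *r j"] exI[of _ "quat_of_complex (cnj z)"])
        (simp add: upper_complex_def quat_of_complex_def)
  qed
qed

section \<open>Existence of Schur forms\<close>

definition qinner :: "quat ^ 'n \<Rightarrow> quat ^ 'n \<Rightarrow> quat" where
  "qinner x y = (\<Sum>i\<in>UNIV. qcnj (x $ i) * y $ i)"

lemma qinner_rscale_right: "qinner x (y *r c) = qinner x y * c"
  by (simp add: qinner_def sum_distrib_right mult.assoc)

lemma qinner_0_right [simp]: "qinner x 0 = 0"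
  by (simp add: qinner_def)

lemma qinner_add_right: "qinner x (y + z) = qinner x y + qinner x z"
  by (simp add: qinner_def sum.distrib algebra_simps)

lemma qinner_diff_right: "qinner x (y - z) = qinner x y - qinner x z"
  by (simp add: qinner_def sum_subtractf algebra_simps)

lemma qinner_sum_right: "qinner x (\<Sum>i\<in>I. f i) = (\<Sum>i\<in>I. qinner x (f i))"
  by (induction I rule: infinite_finite_induct) (simp_all add: qinner_add_right)

lemma qcnj_qinner: "qcnj (qinner x y) = qinner y x"
  by (simp add: qinner_def qcnj_sum qcnj_mult)

lemma qinner_self: "qinner x x = quat_of_real (\<Sum>i\<in>UNIV. qnorm2 (x $ i))"
  by (simp add: qinner_def qcnj_mult_self quat_of_real_sum)

text \<open>The factor is the inverse square root of \<open>qinner x x\<close>. It is kept real so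
  that it commutes with eigenvalues.\<close>

lemma ex_normalize:
  assumes "x \<noteq> 0"
  shows "\<exists>r. r \<noteq> 0 \<and> qinner (x *r quat_of_real r) (x *r quat_of_real r) = 1"
proof -
  define s where "s = (\<Sum>i\<in>UNIV. qnorm2 (x $ i))"
  have "s \<noteq> 0" using assms
    by (auto simp: s_def sum_nonneg_eq_0_iff qnorm2_nonneg qnorm2_eq_0_iff vec_eq_iff)
  moreover have "s \<ge> 0" by (simp add: s_def sum_nonneg qnorm2_nonneg)
  ultimately have s: "s > 0" by simp
  define r where "r = 1 / sqrt s"
  have "r \<noteq> 0" "r * r * s = 1" using s by (simp_all add: r_def)
  have "qinner (x *r quat_of_real r) (x *r quat_of_real r) =
      qinner (x *r quat_of_real r) x * quat_of_real r"
    by (simp add: qinner_rscale_right)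
  also have "qinner (x *r quat_of_real r) x = qcnj (qinner x (x *r quat_of_real r))"
    by (simp add: qcnj_qinner)
  also have "\<dots> * quat_of_real r = quat_of_real (r * s * r)"
    by (simp add: qinner_rscale_right qcnj_mult qinner_self s_def[symmetric] quat_of_real_mult)
  also have "\<dots> = 1" using \<open>r * r * s = 1\<close> by (simp add: mult.commute mult.left_commute)
  finally show ?thesis using \<open>r \<noteq> 0\<close> by blast
qed

definition orthonormal_on :: "'i set \<Rightarrow> ('i \<Rightarrow> quat ^ 'n) \<Rightarrow> bool" where
  "orthonormal_on J v \<longleftrightarrow> (\<forall>i\<in>J. \<forall>j\<in>J. qinner (v i) (v j) = (if i = j then 1 else 0))"

lemma qinner_orthonormal_sum:
  assumes "orthonormal_on J v" "finite J" "i \<in> J"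
  shows "qinner (v i) (\<Sum>j\<in>J. v j *r c j) = c i"
proof -
  have "qinner (v i) (\<Sum>j\<in>J. v j *r c j) = (\<Sum>j\<in>J. if i = j then c j else 0)"
    unfolding qinner_sum_right
    by (rule sum.cong) (use assms in \<open>auto simp: orthonormal_on_def qinner_rscale_right\<close>)
  then show ?thesis using assms by simp
qed

text \<open>The vectors \<open>v j\<close> with \<open>j \<in> J\<close> are the columns
  of the unitary matrix found so far, and \<open>t\<close> holds the corresponding entries of the triangular matrix.\<close>

lemma ex_partial_schur:
  fixes A :: "quat ^ 'n::{finite,linorder} ^ 'n::{finite,linorder}" and J :: "'n set"
  shows "\<exists>v t. orthonormal_on J v \<and> (\<forall>j\<in>J. A *v v j = (\<Sum>i\<in>J. v i *r t i j) \<and>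
    t j j \<in> upper_complex \<and> (\<forall>i\<in>J. j < i \<longrightarrow> t i j = 0))"
  using finite[of J]
proof (induction J rule: finite_linorder_max_induct)
  case empty
  then show ?case by (simp add: orthonormal_on_def)
next
  \<comment> \<open>Indices arrive in increasing order: \<open>b\<close> exceeds all of
    \<open>J\<close>, so the new column may involve every earlier vector.\<close>
  case (insert b J)
  from insert.IH obtain v t where on: "orthonormal_on J v"
    and Av: "\<And>j. j \<in> J \<Longrightarrow> A *v v j = (\<Sum>i\<in>J. v i *r t i j)"
    and t: "\<And>j. j \<in> J \<Longrightarrow> t j j \<in> upper_complex" "\<And>i j. i \<in> J \<Longrightarrow> j \<in> J \<Longrightarrow> j < i \<Longrightarrow> t i j = 0"
    by blast
  have b: "b \<notin> J" using insert.hyps by auto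
  define S where "S = range (\<lambda>c. \<Sum>i\<in>J. v i *r c i)"
  have S: "right_subspace S"
    unfolding right_subspace_def
  proof (intro conjI ballI allI)
    show "0 \<in> S" unfolding S_def by (rule range_eqI[of _ _ "\<lambda>_. 0"]) simp
    fix x assume "x \<in> S"
    then obtain c where x: "x = (\<Sum>i\<in>J. v i *r c i)" by (auto simp: S_def)
    show "x *r d \<in> S" for d unfolding S_def
      by (rule range_eqI[of _ _ "\<lambda>i. c i * d"]) (simp add: x rscale_sum_left rscale_rscale)
    fix y assume "y \<in> S"
    then obtain c' where y: "y = (\<Sum>i\<in>J. v i *r c' i)" by (auto simp: S_def)
    show "x + y \<in> S" unfolding S_def
      by (rule range_eqI[of _ _ "\<lambda>i. c i + c' i"]) (simp add: x y rscale_add_right sum.distrib)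
  qed
  have vS: "v j \<in> S" if "j \<in> J" for j unfolding S_def
    by (rule range_eqI[of _ _ "\<lambda>i. if i = j then 1 else 0"]) (simp add: that if_distrib cong: if_cong)
  have AS: "A *v x \<in> S" if xS: "x \<in> S" for x
  proof -
    obtain c where x: "x = (\<Sum>i\<in>J. v i *r c i)" using xS by (auto simp: S_def)
    have "A *v v j \<in> S" if "j \<in> J" for j using Av[OF that] by (auto simp: S_def)
    then show ?thesis unfolding x matrix_vector_sum matrix_vector_rscale
      by (intro right_subspace_sum[OF S] right_subspace_rscale[OF S])
  qed
  \<comment> \<open>Fewer than n equations leave a nonzero \<open>y\<close> orthogonal to all
    \<open>v j\<close>; it witnesses that \<open>S\<close> is proper.\<close>
  have "card J < card (UNIV :: 'n set)" using b by (intro psubset_card_mono) auto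
  from homogeneous_system_nontrivial[OF _ _ this, of "\<lambda>j i. qcnj (v j $ i)"] obtain c where
    c: "\<exists>i. c i \<noteq> 0" "\<And>j. j \<in> J \<Longrightarrow> (\<Sum>i\<in>UNIV. qcnj (v j $ i) * c i) = 0" by auto
  define y where "y = (\<chi> i. c i)"
  have y: "y \<noteq> 0" "\<And>j. j \<in> J \<Longrightarrow> qinner (v j) y = 0"
    using c by (auto simp: y_def vec_eq_iff qinner_def)
  have "y \<notin> S"
  proof
    assume "y \<in> S"
    then obtain d where d: "y = (\<Sum>i\<in>J. v i *r d i)" by (auto simp: S_def)
    then have "d i = 0" if "i \<in> J" for i
      using qinner_orthonormal_sum[OF on _ that, of d] y(2)[OF that] by simp
    then show False using d y(1) by simp
  qed
  from ex_eigenvector_mod_subspace[OF S this, of A] obtain x z where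
    x: "x \<notin> S" "z \<in> upper_complex" "A *v x - x *r z \<in> S" by blast
  \<comment> \<open>Removing the orthogonal projection onto \<open>S\<close> keeps \<open>x\<close>
    an eigenvector modulo \<open>S\<close>, since \<open>S\<close> is invariant under
    \<open>A\<close>.\<close>
  define p where "p = (\<Sum>j\<in>J. v j *r qinner (v j) x)"
  have pS: "p \<in> S" by (auto simp: p_def S_def)
  have orth: "qinner (v j) (x - p) = 0" if "j \<in> J" for j
    using qinner_orthonormal_sum[OF on _ that, of "\<lambda>j. qinner (v j) x"]
    by (simp add: p_def qinner_diff_right)
  have "x - p \<noteq> 0" using x(1) pS by auto
  from ex_normalize[OF this] obtain r where
    r: "r \<noteq> 0" "qinner ((x - p) *r quat_of_real r) ((x - p) *r quat_of_real r) = 1" by blast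
  define u where "u = (x - p) *r quat_of_real r"
  have uv: "qinner (v j) u = 0" "qinner u (v j) = 0" if "j \<in> J" for j
    using orth[OF that] qcnj_qinner[of "v j" u] by (simp_all add: u_def qinner_rscale_right)
  have "A *v u - u *r z = (A *v x - x *r z - (A *v p - p *r z)) *r quat_of_real r"
    by (simp add: u_def matrix_vector_rscale matrix_vector_mult_diff_distrib rscale_diff_left
        rscale_rscale quat_of_real_commute[symmetric])
  also have "\<dots> \<in> S"
    by (intro right_subspace_rscale[OF S] right_subspace_diff[OF S] x AS pS)
  finally obtain d where d: "A *v u - u *r z = (\<Sum>i\<in>J. v i *r d i)" by (auto simp: S_def)
  define v' where "v' = v(b := u)"
  \<comment> \<open>Column \<open>b\<close> has \<open>z\<close> on the diagonal and
    \<open>d\<close> above it; row \<open>b\<close> vanishes in the earlier columns.\<close>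
  define t' where "t' = (\<lambda>i j. if j = b then if i = b then z else d i else if i = b then 0 else t i j)"
  have sum_v': "(\<Sum>i\<in>insert b J. v' i *r t' i j) = u *r t' b j + (\<Sum>i\<in>J. v i *r t' i j)" for j
  proof -
    have "(\<Sum>i\<in>J. v' i *r t' i j) = (\<Sum>i\<in>J. v i *r t' i j)"
      by (rule sum.cong) (use b in \<open>auto simp: v'_def\<close>)
    then show ?thesis using b by (simp add: v'_def)
  qed
  have "orthonormal_on (insert b J) v'"
    using on uv r(2) b by (auto simp: orthonormal_on_def v'_def u_def[symmetric])
  moreover have "A *v v' j = (\<Sum>i\<in>insert b J. v' i *r t' i j)" if "j \<in> insert b J" for j
  proof (cases "j = b")
    case True
    have "(\<Sum>i\<in>J. v i *r t' i b) = (\<Sum>i\<in>J. v i *r d i)"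
      by (rule sum.cong) (use b in \<open>auto simp: t'_def\<close>)
    then show ?thesis unfolding True sum_v'
      using d by (simp add: v'_def t'_def algebra_simps)
  next
    case False
    have "(\<Sum>i\<in>J. v i *r t' i j) = (\<Sum>i\<in>J. v i *r t i j)"
      by (rule sum.cong) (use b False in \<open>auto simp: t'_def\<close>)
    then show ?thesis unfolding sum_v'
      using Av[of j] that False by (simp add: v'_def t'_def)
  qed
  moreover have "t' j j \<in> upper_complex" if "j \<in> insert b J" for j
    using that t(1) x(2) by (auto simp: t'_def)
  moreover have "t' i j = 0" if "i \<in> insert b J" "j \<in> insert b J" "j < i" for i j
    using that t(2) insert.hyps(2) b by (auto simp: t'_def)
  ultimately show ?case by blast
qed

lemma ex_schur_form:
  fixes A :: "quat ^ 'n::{finite,linorder} ^ 'n::{finite,linorder}"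
  shows "\<exists>T. schur_form A T"
proof -
  obtain v t where on: "orthonormal_on UNIV v" and Av: "\<And>j. A *v v j = (\<Sum>i\<in>UNIV. v i *r t i j)"
    and t: "\<And>j::'n. t j j \<in> upper_complex" "\<And>i j. j < i \<Longrightarrow> t i j = 0"
    using ex_partial_schur[of UNIV A] by auto
  define U T where "U = (\<chi> i j. v j $ i)" and "T = (\<chi> i j. t i j)"
  have T_nth: "T $ i $ j = t i j" for i j by (simp add: T_def)
  have UU: "conj_transpose U ** U = mat 1"
    using on by (simp add: conj_transpose_def U_def matrix_matrix_mult_def mat_def vec_eq_iff
        orthonormal_on_def qinner_def)
  \<comment> \<open>For a square matrix, orthonormal columns already give a two-sided
    inverse.\<close>
  then have "U ** conj_transpose U = mat 1" by (rule matrix_left_right_inverse_division_ring)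
  then have "unitary U" using UU by (simp add: unitary_def)
  moreover have "A ** U = U ** T"
  proof -
    have "(A ** U) $ i $ j = (A *v v j) $ i" for i j
      by (simp add: matrix_matrix_mult_def matrix_vector_mult_def U_def)
    also have "\<dots> i j = (U ** T) $ i $ j" for i j
      by (simp add: Av matrix_matrix_mult_def U_def T_def)
    finally show ?thesis by (simp add: vec_eq_iff)
  qed
  then have "T = conj_transpose U ** A ** U"
    by (simp add: matrix_mul_assoc[symmetric]) (simp add: matrix_mul_assoc UU)
  ultimately have "schur_form A T"
    using t unfolding schur_form_def upper_triangular_def T_nth by blast
  then show ?thesis by blast
qed

section \<open>Class eigenspaces\<close>

text \<open>If \<open>A y = y p\<close> then \<open>A (y c) = (y c) (c^-1 p c)\<close> for nonzero
  \<open>c\<close>, and \<open>c^-1 p c\<close> stays in the class of \<open>q\<close>.\<close>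

lemma right_subspace_class_eigenspace: "right_subspace (class_eigenspace A q)"
  unfolding right_subspace_def
proof (intro conjI ballI allI)
  show "0 \<in> class_eigenspace A q"
    unfolding class_eigenspace_def by (intro CollectI exI[of _ "[]"]) auto
  fix x assume "x \<in> class_eigenspace A q"
  then obtain xs where xs: "x = sum_list xs" "set xs \<subseteq> (\<Union>p\<in>qclass q. eigenvectors A p)"
    by (auto simp: class_eigenspace_def)
  show "x *r c \<in> class_eigenspace A q" for c
  proof -
    have mem: "y *r c \<in> (\<Union>p\<in>qclass q. eigenvectors A p)" if y: "y \<in> set xs" for y
    proof -
      obtain p where p: "p \<in> qclass q" "A *v y = y *r p"
        using xs(2) y unfolding eigenvectors_def by blast
      show ?thesis
      proof (cases "c = 0")
        case True
        then show ?thesis using p(1) by (auto simp: eigenvectors_def)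
      next
        case False
        obtain h where h: "h \<noteq> 0" "p = inverse h * q * h"
          using p(1) by (auto simp: qclass_def qsimilar_def)
        have "inverse c * p * c \<in> qclass q" unfolding qclass_def qsimilar_def
          by (intro CollectI exI[of _ "h * c"])
            (use False h in \<open>simp add: nonzero_inverse_mult_distrib mult.assoc\<close>)
        moreover have "c * (inverse c * (p * c)) = p * c"
          using False by (simp add: mult.assoc[symmetric])
        then have "A *v (y *r c) = y *r c *r (inverse c * p * c)"
          using p(2) by (simp add: matrix_vector_rscale rscale_rscale mult.assoc)
        ultimately show ?thesis by (auto simp: eigenvectors_def)
      qed
    qed
    have "sum_list xs *r c = sum_list (map (\<lambda>y. y *r c) xs)"
      by (induction xs) (simp_all add: rscale_add_left)
    then show ?thesis unfolding class_eigenspace_def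
      using mem xs(1) by (intro CollectI exI[of _ "map (\<lambda>y. y *r c) xs"]) auto
  qed
  fix y assume "y \<in> class_eigenspace A q"
  then obtain ys where ys: "y = sum_list ys" "set ys \<subseteq> (\<Union>p\<in>qclass q. eigenvectors A p)"
    by (auto simp: class_eigenspace_def)
  show "x + y \<in> class_eigenspace A q" unfolding class_eigenspace_def
    using xs ys by (intro CollectI exI[of _ "xs @ ys"]) auto
qed

text \<open>All members of a similarity class are roots of the same real quadratic polynomial; evaluated
  at \<open>A\<close> it commutes with right scaling, so it annihilates the whole class eigenspace.\<close>

definition class_quadratic :: "quat \<Rightarrow> quat ^ 'n ^ 'n \<Rightarrow> quat ^ 'n \<Rightarrow> quat ^ 'n" where
  "class_quadratic q A x = A *v (A *v x) - (A *v x) *r quat_of_real (2 * qre q)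
    + x *r quat_of_real (qnorm2 q)"

lemma class_quadratic_0 [simp]: "class_quadratic q A 0 = 0"
  by (simp add: class_quadratic_def)

lemma class_quadratic_add:
  "class_quadratic q A (x + y) = class_quadratic q A x + class_quadratic q A y"
  by (simp add: class_quadratic_def matrix_vector_right_distrib rscale_add_left algebra_simps)

lemma class_quadratic_rscale: "class_quadratic q A (x *r c) = class_quadratic q A x *r c"
  by (simp add: class_quadratic_def matrix_vector_rscale rscale_rscale rscale_add_left
      rscale_diff_left quat_of_real_commute)

lemma class_quadratic_sum:
  "class_quadratic q A (\<Sum>i\<in>I. f i) = (\<Sum>i\<in>I. class_quadratic q A (f i))"
  by (induction I rule: infinite_finite_induct) (simp_all add: class_quadratic_add)

text \<open>On an eigenvector for \<open>p\<close> the operator is right multiplication by the value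
  of the quadratic at \<open>p\<close>, which is zero.\<close>

lemma class_quadratic_class_eigenspace:
  assumes "x \<in> class_eigenspace A q"
  shows "class_quadratic q A x = 0"
proof -
  obtain xs where xs: "x = sum_list xs" "set xs \<subseteq> (\<Union>p\<in>qclass q. eigenvectors A p)"
    using assms by (auto simp: class_eigenspace_def)
  have "class_quadratic q A y = 0" if "p \<in> qclass q" "y \<in> eigenvectors A p" for p y
  proof -
    have "class_quadratic q A y =
        y *r (p * p - p * quat_of_real (2 * qre q) + quat_of_real (qnorm2 q))"
      using that(2) by (simp add: eigenvectors_def class_quadratic_def matrix_vector_rscale
          rscale_rscale rscale_add_right rscale_diff_right)
    then show ?thesis using qsimilar_quadratic[of p q] that(1) by (simp add: qclass_def)
  qed
  then have "class_quadratic q A (sum_list xs) = 0"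
    using xs(2) by (induction xs) (auto simp: class_quadratic_add)
  then show ?thesis by (simp add: xs(1))
qed

section \<open>Triangular matrices and the dimension bound\<close>

lemma upper_triangular_mult_nth:
  assumes "upper_triangular T" "\<And>k. i < k \<Longrightarrow> x $ k = 0" "i \<le> k"
  shows "(T *v x) $ k = T $ k $ k * x $ k"
proof -
  have "(T *v x) $ k = (\<Sum>j\<in>UNIV. if j = k then T $ k $ k * x $ k else 0)"
    unfolding matrix_vector_mult_def vec_lambda_beta
  proof (rule sum.cong[OF refl])
    fix j
    \<comment> \<open>Left of the diagonal \<open>T\<close> vanishes, right of it \<open>x\<close>
      does.\<close>
    consider "j < k" | "j = k" | "i < j" "j \<noteq> k" using assms(3) by fastforce
    then show "T $ k $ j * x $ j = (if j = k then T $ k $ k * x $ k else 0)"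
      by cases (use assms(1,2) in \<open>auto simp: upper_triangular_def\<close>)
  qed
  then show ?thesis by simp
qed

text \<open>This is injectivity of restricting kernel vectors to the positions where the diagonal
  entry is \<open>class_rep q\<close>.\<close>

lemma upper_triangular_class_quadratic_kernel:
  fixes T :: "quat ^ 'n::{finite,linorder} ^ 'n::{finite,linorder}"
  assumes tri: "upper_triangular T" and diag: "\<And>i. T $ i $ i \<in> upper_complex"
    and ker: "class_quadratic q T w = 0"
    and supp: "\<And>i. T $ i $ i = class_rep q \<Longrightarrow> w $ i = 0"
  shows "w = 0"
proof (rule ccontr)
  assume "w \<noteq> 0"
  then have ne: "{i. w $ i \<noteq> 0} \<noteq> {}" by (auto simp: vec_eq_iff)
  define i where "i = Max {i. w $ i \<noteq> 0}"
  have wi: "w $ i \<noteq> 0" using Max_in[OF _ ne] by (simp add: i_def)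
  have above: "w $ k = 0" if "i < k" for k
  proof (rule ccontr)
    assume "w $ k \<noteq> 0"
    then have "k \<le> i" by (simp add: i_def)
    then show False using that by simp
  qed
  define z where "z = T $ i $ i"
  have Tw: "(T *v w) $ k = T $ k $ k * w $ k" if "i \<le> k" for k
    using upper_triangular_mult_nth[OF tri above that] by simp
  \<comment> \<open>By \<open>Tw\<close>, the vector \<open>T *v w\<close> also vanishes beyond
    \<open>i\<close>, so the product formula applies a second time.\<close>
  then have "(T *v (T *v w)) $ i = z * (z * w $ i)"
    using upper_triangular_mult_nth[OF tri, of i "T *v w" i] above by (simp add: z_def)
  then have "z * (z * w $ i) - z * w $ i * quat_of_real (2 * qre q)
      + w $ i * quat_of_real (qnorm2 q) = 0"
    using arg_cong[OF ker, of "\<lambda>x. x $ i"] Tw[of i] by (simp add: class_quadratic_def z_def)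
  \<comment> \<open>Real coefficients are central, so \<open>w $ i\<close> factors out on the right
    and can be cancelled.\<close>
  then have "(z * z - z * quat_of_real (2 * qre q) + quat_of_real (qnorm2 q)) * w $ i = 0"
    by (simp add: algebra_simps quat_of_real_commute)
  then have "z * z - z * quat_of_real (2 * qre q) + quat_of_real (qnorm2 q) = 0"
    using wi by simp
  then have "z = class_rep q"
    using upper_complex_root_eq_class_rep diag by (simp add: z_def)
  then show False using supp wi by (simp add: z_def)
qed

text \<open>With more vectors than such positions, some nontrivial combination has zero coordinates
  there in the Schur basis; being in the kernel of the quadratic, it vanishes, against
  independence.\<close>

lemma right_independent_class_eigenspace_card_le:
  fixes A :: "quat ^ 'n::{finite,linorder} ^ 'n::{finite,linorder}"
  assumes "schur_form A T" "right_independent B" "B \<subseteq> class_eigenspace A q"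
  shows "card B \<le> card {i. T $ i $ i = class_rep q}"
proof (rule ccontr)
  assume *: "\<not> ?thesis"
  obtain U where U: "unitary U" and T: "T = conj_transpose U ** A ** U"
    and tri: "upper_triangular T" and diag: "\<And>i. T $ i $ i \<in> upper_complex"
    using assms(1) by (auto simp: schur_form_def)
  define V where "V = conj_transpose U"
  have UV: "U *v (V *v x) = x" for x
    using U by (simp add: unitary_def V_def matrix_vector_mul_assoc)
  have TV: "T *v (V *v x) = V *v (A *v x)" for x
    using UV by (simp add: T V_def matrix_vector_mul_assoc[symmetric])
  \<comment> \<open>The change of coordinates \<open>V\<close> carries \<open>A\<close> to
    \<open>T\<close>, so it intertwines the two quadratics.\<close>
  have quad: "class_quadratic q T (V *v x) = V *v class_quadratic q A x" for x
    by (simp add: class_quadratic_def TV matrix_vector_right_distrib matrix_vector_rscale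
        matrix_vector_mult_diff_distrib)
  \<comment> \<open>An infinite set has \<open>card\<close> equal to 0, which cannot exceed a
    natural number.\<close>
  have fin: "finite B" using * by (metis card.infinite le0)
  have "card {i. T $ i $ i = class_rep q} < card B" using * by simp
  from homogeneous_system_nontrivial[OF _ fin this, of "\<lambda>i v. (V *v v) $ i"] obtain c where
    c: "\<exists>v\<in>B. c v \<noteq> 0" "\<And>i. T $ i $ i = class_rep q \<Longrightarrow> (\<Sum>v\<in>B. (V *v v) $ i * c v) = 0"
    by auto
  define x where "x = (\<Sum>v\<in>B. v *r c v)"
  have "class_quadratic q A x = 0"
    unfolding x_def class_quadratic_sum class_quadratic_rscale
  proof (intro sum.neutral ballI)
    fix v assume "v \<in> B"
    then have "class_quadratic q A v = 0"
      using assms(3) class_quadratic_class_eigenspace by blast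
    then show "class_quadratic q A v *r c v = 0" by simp
  qed
  then have "class_quadratic q T (V *v x) = 0" by (simp add: quad)
  moreover have "(V *v x) $ i = 0" if "T $ i $ i = class_rep q" for i
    using c(2)[OF that] by (simp add: x_def matrix_vector_sum matrix_vector_rscale)
  ultimately have "V *v x = 0"
    by (rule upper_triangular_class_quadratic_kernel[OF tri diag])
  then have "U *v (V *v x) = 0" by simp
  then have "(\<Sum>v\<in>B. v *r c v) = 0" by (simp only: UV x_def[symmetric])
  then have "\<forall>v\<in>B. c v = 0"
    using assms(2)[unfolded right_independent_def, rule_format, of B c] fin by simp
  then show False using c(1) by blast
qed

theorem proposition2p3:
  fixes A :: "quat ^ 'n::{finite,linorder} ^ 'n::{finite,linorder}" and q :: quat
  assumes "right_eigenvalue A q"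
  shows "alg_mult q A \<ge> geom_mult q A"
proof -
  define V where "V = class_eigenspace A q"
  define B where "B = (SOME B. right_independent B \<and> right_span B = V)"
  \<comment> \<open>The class eigenspace is a right subspace, so the choice made in
    \<open>right_dim\<close> is a genuine basis.\<close>
  have B: "right_independent B" "right_span B = V"
    using someI_ex[OF right_subspace_has_basis[OF right_subspace_class_eigenspace[of A q]]]
    by (simp_all add: B_def V_def)
  have "B \<subseteq> right_span B"
  proof
    fix v assume "v \<in> B"
    then show "v \<in> right_span B" unfolding right_span_def
      by (intro CollectI exI[of _ "{v}"] exI[of _ "\<lambda>_. 1"]) auto
  qed
  moreover have "schur_form A (SOME T. schur_form A T)"
    by (rule someI_ex[OF ex_schur_form])
  ultimately have "card B \<le> card {i. (SOME T. schur_form A T) $ i $ i = class_rep q}"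
    using right_independent_class_eigenspace_card_le B by (simp add: V_def)
  then show ?thesis
    by (simp add: alg_mult_def geom_mult_def right_dim_def Let_def B_def V_def)
qed

end
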